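(* Suppose that $u$, $u_n$, $n=1,2,\ldots$, are fuzzy sets in $F^1_{USC}(X)$. If $([u]_0,d)$ is separable, then the following are equivalent: (i) $\lim^{(\Gamma)}_{n\to\infty}u_n=u$; (ii) $\lim^{(K)}_{n\to\infty}[u_n]_\alpha=[u]_\alpha$ holds a.e. on $\alpha\in(0,1)$; (iii) $\lim^{(K)}_{n\to\infty}[u_n]_\alpha=[u]_\alpha$ holds for all $\alpha\in(0,1)\setminus P(u)$; (iv) there is a dense subset $P$ of $(0,1)\setminus P(u)$ such that $\lim^{(K)}_{n\to\infty}[u_n]_\alpha=[u]_\alpha$ holds for $\alpha\in P$; (v) there is a countable dense subset $P$ of $(0,1)\setminus P(u)$ such that $\lim^{(K)}_{n\to\infty}[u_n]_\alpha=[u]_\alpha$ holds for $\alpha\in P$.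
   Context: $(X,d)$ is a nonempty metric space. $X\times[0,1]$ carries the metric $\overline d((x,\alpha),(y,\beta))=d(x,y)+|\alpha-\beta|$. A fuzzy set in $X$ is a function $u:X\to[0,1]$, with $\{u>\alpha\}=\{x\in X:u(x)>\alpha\}$, and $\alpha$-cuts $[u]_\alpha=\{x\in X: u(x)\ge\alpha\}$ for $\alpha\in(0,1]$ and $[u]_0=\overline{\{u>0\}}$ (overline is closure in $X$). $F^1_{USC}(X)$ is the set of fuzzy sets $u$ in $X$ such that $[u]_\alpha$ is nonempty and closed for all $\alpha\in[0,1]$. $P(u)=\{\alpha\in(0,1):\overline{\{u>\alpha\}}\subsetneqq[u]_\alpha\}$. A sequence of sets $\{C_n\}$ in a metric space $Y$ Kuratowski converges to $C\subseteq Y$, written $C=\lim^{(K)}_{n\to\infty}C_n$, if $C=\liminf_{n\to\infty}C_n=\limsup_{n\to\infty}C_n$, where $\liminf_n C_n=\{x\in Y: x=\lim_n x_n,\ x_n\in C_n\}$ and $\limsup_n C_n=\{x\in Y: x=\lim_j x_{n_j},\ x_{n_j}\in C_{n_j}\text{ for some subsequence}\}$. With ${\rm end}\,u=\{(x,t)\in X\times[0,1]:u(x)\ge t\}$, the $\Gamma$-convergence $u=\lim^{(\Gamma)}_{n\to\infty}u_n$ means ${\rm end}\,u=\lim^{(K)}_{n\to\infty}{\rm end}\,u_n$ in $(X\times[0,1],\overline d)$. "a.e." is with respect to Lebesgue measure. "Countable" means finite or countably infinite. *)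

theory Defs
  imports "HOL-Analysis.Analysis"
begin

section \<open>Kuratowski convergence\<close>

text \<open>The metric is an explicit parameter: the notion is needed both for the type class metric of
  \<open>X\<close> and for a metric on \<open>X \<times> [0,1]\<close> other than the Euclidean one of the product type.\<close>

definition Kuratowski_liminf :: "'b set \<Rightarrow> ('b \<Rightarrow> 'b \<Rightarrow> real) \<Rightarrow> (nat \<Rightarrow> 'b set) \<Rightarrow> 'b set" where
  "Kuratowski_liminf Y d C =
     {x \<in> Y. \<exists>s. (\<forall>n. s n \<in> C n) \<and> limitin (Metric_space.mtopology Y d) s x sequentially}"

definition Kuratowski_limsup :: "'b set \<Rightarrow> ('b \<Rightarrow> 'b \<Rightarrow> real) \<Rightarrow> (nat \<Rightarrow> 'b set) \<Rightarrow> 'b set" where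
  "Kuratowski_limsup Y d C =
     {x \<in> Y. \<exists>r s. strict_mono (r :: nat \<Rightarrow> nat) \<and> (\<forall>j. s j \<in> C (r j)) \<and>
                   limitin (Metric_space.mtopology Y d) s x sequentially}"

definition Kuratowski_converges ::
    "'b set \<Rightarrow> ('b \<Rightarrow> 'b \<Rightarrow> real) \<Rightarrow> (nat \<Rightarrow> 'b set) \<Rightarrow> 'b set \<Rightarrow> bool" where
  "Kuratowski_converges Y d C L \<longleftrightarrow>
     L = Kuratowski_liminf Y d C \<and> L = Kuratowski_limsup Y d C"

section \<open>Fuzzy sets\<close>

text \<open>The metric space \<open>X\<close> is the whole type \<open>'a\<close> (types are nonempty). Fuzzy sets are real-valued
  functions; the requirement that their values lie in \<open>[0,1]\<close> is part of \<open>F1_USC\<close>.\<close>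

definition fuzzy_cut :: "('a::metric_space \<Rightarrow> real) \<Rightarrow> real \<Rightarrow> 'a set" where
  "fuzzy_cut u \<alpha> = (if \<alpha> = 0 then closure {x. u x > 0} else {x. u x \<ge> \<alpha>})"

definition F1_USC :: "('a::metric_space \<Rightarrow> real) set" where
  "F1_USC = {u. (\<forall>x. u x \<in> {0..1}) \<and> (\<forall>\<alpha>\<in>{0..1}. fuzzy_cut u \<alpha> \<noteq> {} \<and> closed (fuzzy_cut u \<alpha>))}"

definition P_set :: "('a::metric_space \<Rightarrow> real) \<Rightarrow> real set" where
  "P_set u = {\<alpha> \<in> {0<..<1}. closure {x. u x > \<alpha>} \<subset> fuzzy_cut u \<alpha>}"

definition endograph :: "('a::metric_space \<Rightarrow> real) \<Rightarrow> ('a \<times> real) set" where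
  "endograph u = {(x, t). t \<in> {0..1} \<and> u x \<ge> t}"

definition sum_dist :: "'a::metric_space \<times> real \<Rightarrow> 'a \<times> real \<Rightarrow> real" where
  "sum_dist p q = dist (fst p) (fst q) + \<bar>snd p - snd q\<bar>"

lemma Metric_space_sum_dist: "Metric_space (UNIV \<times> {0..1}) sum_dist"
proof
  fix x y z :: "'a \<times> real"
  show "0 \<le> sum_dist x y"
    by (simp add: sum_dist_def)
  show "sum_dist x y = sum_dist y x"
    by (simp add: sum_dist_def dist_commute abs_minus_commute)
  show "sum_dist x y = 0 \<longleftrightarrow> x = y"
    by (auto simp: sum_dist_def prod_eq_iff add_nonneg_eq_0_iff)
  show "sum_dist x z \<le> sum_dist x y + sum_dist y z"
    using dist_triangle[of "fst x" "fst z" "fst y"] by (simp add: sum_dist_def)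
qed

definition Gamma_converges ::
    "(nat \<Rightarrow> 'a::metric_space \<Rightarrow> real) \<Rightarrow> ('a \<Rightarrow> real) \<Rightarrow> bool" where
  "Gamma_converges us u \<longleftrightarrow>
     Kuratowski_converges (UNIV \<times> {0..1}) sum_dist (\<lambda>n. endograph (us n)) (endograph u)"

definition cut_converges ::
    "(nat \<Rightarrow> 'a::metric_space \<Rightarrow> real) \<Rightarrow> ('a \<Rightarrow> real) \<Rightarrow> real \<Rightarrow> bool" where
  "cut_converges us u \<alpha> \<longleftrightarrow> Kuratowski_converges UNIV dist (\<lambda>n. fuzzy_cut (us n) \<alpha>) (fuzzy_cut u \<alpha>)"

definition dense_subset :: "'b::topological_space set \<Rightarrow> 'b set \<Rightarrow> bool" where
  "dense_subset P S \<longleftrightarrow> P \<subseteq> S \<and> S \<subseteq> closure P"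

end

theory Submission
  imports Defs
begin

text \<open>
  Kuratowski convergence, of endographs as well as of cuts, says two things: every point of the
  limit set is eventually approached, and every point that is frequently approached lies in the
  limit set. Read this way for endographs, \<open>\<Gamma>\<close>-convergence becomes a pair of statements about the
  values \<open>us n y\<close> at points \<open>y\<close> near a given \<open>x\<close>
  (\<open>Gamma_converges_iff\<close>). The levels may be perturbed by \<open>\<epsilon>\<close> there, whereas for a cut
  the level \<open>\<alpha>\<close> is rigid (\<open>cut_converges_iff\<close>). The theorem is about trading this
  slack.

  If \<open>\<alpha>\<close> is not in \<open>P_set u\<close>, every point of the \<open>\<alpha>\<close>-cut is a limit of points with
  \<open>u > \<alpha>\<close>, so a small loss in level is affordable and \<open>\<Gamma>\<close>-convergence gives
  convergence of that cut (\<open>cut_converges_if_Gamma_converges\<close>). Conversely, if the cuts converge at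
  levels lying in every subinterval of \<open>(0,1)\<close>, one of these levels fits into the slack and
  \<open>\<Gamma>\<close>-convergence follows (\<open>Gamma_converges_if_cut_converges_densely\<close>).

  Separability of the support is what makes \<open>P_set u\<close> countable (\<open>countable_P_set\<close>): an exceptional
  level is a local maximum value of \<open>u\<close>, and so the maximum of \<open>u\<close> over one of countably many
  balls. Therefore \<open>P_set u\<close> is a null set, and
  dense subsets of \<open>(0,1) - P_set u\<close> are dense in \<open>(0,1)\<close>. So each condition on the cuts follows
  from convergence on all of \<open>(0,1) - P_set u\<close> and provides converging cuts at levels in every
  subinterval of \<open>(0,1)\<close>.
\<close>

section \<open>Kuratowski convergence through approach within every distance\<close>

text \<open>Nonemptiness matters: if a single \<open>C n\<close> is empty, no sequence selects from all the sets and
  the lower limit is empty. The sequence is built from points of \<open>C n\<close> whose distance to \<open>x\<close> is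
  within \<open>1 / Suc n\<close> of the infimum.\<close>

lemma Kuratowski_liminf_iff:
  assumes M: "Metric_space M d" and sub: "\<And>n. C n \<subseteq> M" and ne: "\<And>n. C n \<noteq> {}"
  shows "x \<in> Kuratowski_liminf M d C \<longleftrightarrow>
           x \<in> M \<and> (\<forall>\<epsilon>>0. \<forall>\<^sub>F n in sequentially. \<exists>y\<in>C n. d x y < \<epsilon>)"
proof -
  interpret Metric_space M d by (rule M)
  show ?thesis
  proof (intro iffI conjI allI impI; (elim conjE)?)
    assume "x \<in> Kuratowski_liminf M d C"
    then show "x \<in> M" by (simp add: Kuratowski_liminf_def)
  next
    fix \<epsilon> :: real
    assume "x \<in> Kuratowski_liminf M d C" and "\<epsilon> > 0"
    then obtain s where s: "\<And>n. s n \<in> C n" "\<forall>\<^sub>F n in sequentially. d (s n) x < \<epsilon>"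
      unfolding Kuratowski_liminf_def limitin_metric by (auto simp: eventually_conj_iff)
    show "\<forall>\<^sub>F n in sequentially. \<exists>y\<in>C n. d x y < \<epsilon>"
      using s(2) by (rule eventually_mono) (metis s(1) commute)
  next
    assume xM: "x \<in> M" and ev: "\<forall>\<epsilon>>0. \<forall>\<^sub>F n in sequentially. \<exists>y\<in>C n. d x y < \<epsilon>"
    define \<delta> where "\<delta> n = Inf (d x ` C n)" for n
    have bdd: "bdd_below (d x ` C n)" for n
      by (rule bdd_belowI[of _ 0]) auto
    have "\<exists>y\<in>C n. d x y < \<delta> n + 1 / Suc n" for n
    proof -
      have "\<delta> n < \<delta> n + 1 / Suc n" by simp
      then show ?thesis
        unfolding \<delta>_def using cInf_lessD[of "d x ` C n"] ne by blast
    qed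
    then obtain s where s: "\<And>n. s n \<in> C n" "\<And>n. d x (s n) < \<delta> n + 1 / Suc n"
      by metis
    have "\<forall>\<^sub>F n in sequentially. s n \<in> M \<and> d (s n) x < \<epsilon>" if "\<epsilon> > 0" for \<epsilon>
    proof -
      have "\<forall>\<^sub>F n in sequentially. \<exists>y\<in>C n. d x y < \<epsilon> / 2"
        using ev half_gt_zero[OF that] by blast
      moreover have "\<forall>\<^sub>F n in sequentially. 1 / Suc n < \<epsilon> / 2"
        using that by (intro order_tendstoD(2)[OF LIMSEQ_inverse_real_of_nat[unfolded inverse_eq_divide]]) simp
      ultimately show ?thesis
      proof eventually_elim
        case (elim n)
        then have "\<delta> n < \<epsilon> / 2"
          unfolding \<delta>_def using cInf_lower[OF _ bdd] by fastforce
        then have "d x (s n) < \<epsilon>"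
          using s(2)[of n] elim(2) by linarith
        then show ?case
          using s(1) sub commute by auto
      qed
    qed
    then have "limitin mtopology s x sequentially"
      using xM by (simp add: limitin_metric)
    then show "x \<in> Kuratowski_liminf M d C"
      using s(1) xM unfolding Kuratowski_liminf_def by blast
  qed
qed

lemma Kuratowski_limsup_iff:
  assumes M: "Metric_space M d" and sub: "\<And>n. C n \<subseteq> M"
  shows "x \<in> Kuratowski_limsup M d C \<longleftrightarrow>
           x \<in> M \<and> (\<forall>\<epsilon>>0. \<exists>\<^sub>F n in sequentially. \<exists>y\<in>C n. d x y < \<epsilon>)"
proof -
  interpret Metric_space M d by (rule M)
  show ?thesis
  proof (intro iffI conjI allI impI; (elim conjE)?)
    assume "x \<in> Kuratowski_limsup M d C"
    then show "x \<in> M" by (simp add: Kuratowski_limsup_def)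
  next
    fix \<epsilon> :: real
    assume "x \<in> Kuratowski_limsup M d C" and "\<epsilon> > 0"
    then obtain r s where r: "strict_mono (r :: nat \<Rightarrow> nat)" and s: "\<And>j. s j \<in> C (r j)"
      and "\<forall>\<^sub>F j in sequentially. d (s j) x < \<epsilon>"
      unfolding Kuratowski_limsup_def limitin_metric by (auto simp: eventually_conj_iff)
    then obtain J where J: "\<And>j. j \<ge> J \<Longrightarrow> d (s j) x < \<epsilon>"
      by (auto simp: eventually_sequentially)
    have "\<exists>n\<ge>N. \<exists>y\<in>C n. d x y < \<epsilon>" for N
    proof (intro exI conjI bexI)
      show "N \<le> r (max J N)"
        using seq_suble[OF r, of "max J N"] by simp
      show "s (max J N) \<in> C (r (max J N))" by (rule s)
      show "d x (s (max J N)) < \<epsilon>" using J[of "max J N"] commute by simp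
    qed
    then show "\<exists>\<^sub>F n in sequentially. \<exists>y\<in>C n. d x y < \<epsilon>"
      by (simp add: frequently_sequentially)
  next
    assume xM: "x \<in> M" and fr: "\<forall>\<epsilon>>0. \<exists>\<^sub>F n in sequentially. \<exists>y\<in>C n. d x y < \<epsilon>"
    have next_index: "\<exists>n\<ge>N. \<exists>y\<in>C n. d x y < 1 / Suc j" for N j
      using fr[rule_format, of "1 / Suc j"] by (auto simp: frequently_sequentially)
    have "\<exists>r. \<forall>j. (\<exists>y\<in>C (r j). d x y < 1 / Suc j) \<and> r j < r (Suc j)"
    proof (rule dependent_nat_choice)
      show "\<exists>n. \<exists>y\<in>C n. d x y < 1 / real (Suc 0)"
        using next_index by blast
      show "\<exists>m. (\<exists>y\<in>C m. d x y < 1 / real (Suc (Suc j))) \<and> n < m" for n j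
        using next_index[of "Suc n" "Suc j"] by (auto simp: Suc_le_eq)
    qed
    then obtain r where r: "\<And>j. \<exists>y\<in>C (r j). d x y < 1 / Suc j" "\<And>j. r j < r (Suc j)"
      by blast
    then obtain s where s: "\<And>j. s j \<in> C (r j)" "\<And>j. d x (s j) < 1 / Suc j"
      by metis
    have "\<forall>\<^sub>F j in sequentially. s j \<in> M \<and> d (s j) x < \<epsilon>" if "\<epsilon> > 0" for \<epsilon>
    proof -
      have "\<forall>\<^sub>F j in sequentially. 1 / Suc j < \<epsilon>"
        using that by (intro order_tendstoD(2)[OF LIMSEQ_inverse_real_of_nat[unfolded inverse_eq_divide]])
      then show ?thesis
      proof eventually_elim
        case (elim j)
        then have "d x (s j) < \<epsilon>" using s(2)[of j] by linarith
        then show ?case using s(1) sub commute by auto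
      qed
    qed
    then have "limitin mtopology s x sequentially"
      using xM by (simp add: limitin_metric)
    moreover have "strict_mono r"
      using r(2) by (simp add: strict_mono_Suc_iff)
    ultimately show "x \<in> Kuratowski_limsup M d C"
      using s(1) xM unfolding Kuratowski_limsup_def by blast
  qed
qed

lemma Kuratowski_converges_iff:
  assumes M: "Metric_space M d" and sub: "\<And>n. C n \<subseteq> M" and ne: "\<And>n. C n \<noteq> {}" and L: "L \<subseteq> M"
  shows "Kuratowski_converges M d C L \<longleftrightarrow>
           (\<forall>x\<in>L. \<forall>\<epsilon>>0. \<forall>\<^sub>F n in sequentially. \<exists>y\<in>C n. d x y < \<epsilon>) \<and>
           (\<forall>x\<in>M. (\<forall>\<epsilon>>0. \<exists>\<^sub>F n in sequentially. \<exists>y\<in>C n. d x y < \<epsilon>) \<longrightarrow> x \<in> L)"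
proof -
  note liminf = Kuratowski_liminf_iff[OF M sub ne] and limsup = Kuratowski_limsup_iff[OF M sub]
  have "Kuratowski_liminf M d C \<subseteq> Kuratowski_limsup M d C"
    by (auto simp: liminf limsup intro!: eventually_frequently)
  then have "Kuratowski_converges M d C L \<longleftrightarrow>
      L \<subseteq> Kuratowski_liminf M d C \<and> Kuratowski_limsup M d C \<subseteq> L"
    unfolding Kuratowski_converges_def by blast
  also have "\<dots> \<longleftrightarrow> (\<forall>x\<in>L. \<forall>\<epsilon>>0. \<forall>\<^sub>F n in sequentially. \<exists>y\<in>C n. d x y < \<epsilon>) \<and>
           (\<forall>x\<in>M. (\<forall>\<epsilon>>0. \<exists>\<^sub>F n in sequentially. \<exists>y\<in>C n. d x y < \<epsilon>) \<longrightarrow> x \<in> L)"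
    using L by (auto simp: liminf limsup subset_iff)
  finally show ?thesis .
qed

section \<open>Convergence of endographs and of cuts in terms of values\<close>

lemma F1_USC_values:
  assumes "u \<in> F1_USC"
  shows "0 \<le> u x" and "u x \<le> 1"
  using assms by (auto simp: F1_USC_def)

lemma value_near_if_endograph_near:
  assumes "p \<in> endograph v" and "sum_dist (x, t) p < \<epsilon>"
  shows "\<exists>y. dist x y < \<epsilon> \<and> t - \<epsilon> < v y"
proof (cases p)
  case (Pair y s)
  with assms have "s \<le> v y" "dist x y + \<bar>t - s\<bar> < \<epsilon>"
    by (auto simp: endograph_def sum_dist_def)
  then show ?thesis
    using zero_le_dist[of x y] by (intro exI[of _ y]) linarith
qed

text \<open>Half of the distance is spent on the point, half on the level; capping the value at \<open>t\<close> keeps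
  the level within reach when \<open>v\<close> is much larger than \<open>t\<close>.\<close>

lemma endograph_near_if_value_near:
  assumes "t \<in> {0..1}" and "0 \<le> v y" and "dist x y < \<epsilon> / 2" and "t - \<epsilon> / 2 < v y"
  shows "\<exists>p\<in>endograph v. sum_dist (x, t) p < \<epsilon>"
proof (rule bexI[of _ "(y, min t (v y))"])
  have "\<bar>t - min t (v y)\<bar> < \<epsilon> / 2"
    using assms(3,4) zero_le_dist[of x y] by linarith
  then show "sum_dist (x, t) (y, min t (v y)) < \<epsilon>"
    using assms(3) unfolding sum_dist_def by simp
  show "(y, min t (v y)) \<in> endograph v"
    using assms(1,2) by (auto simp: endograph_def min_def)
qed

text \<open>In the first condition it suffices to approach the top point \<open>(x, u x)\<close> of each fibre of the
  endograph. In the second, level \<open>0\<close> may be left out because \<open>0 \<le> u x\<close> always holds.\<close>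

lemma Gamma_converges_iff:
  assumes u: "u \<in> F1_USC" and us: "\<And>n. us n \<in> F1_USC"
  shows "Gamma_converges us u \<longleftrightarrow>
    (\<forall>x. \<forall>\<epsilon>>0. \<forall>\<^sub>F n in sequentially. \<exists>y. dist x y < \<epsilon> \<and> u x - \<epsilon> < us n y) \<and>
    (\<forall>x. \<forall>t\<in>{0<..1}.
       (\<forall>\<epsilon>>0. \<exists>\<^sub>F n in sequentially. \<exists>y. dist x y < \<epsilon> \<and> t - \<epsilon> < us n y) \<longrightarrow> t \<le> u x)"
    (is "_ \<longleftrightarrow> ?low \<and> ?upp")
proof -
  let ?near = "\<lambda>x t \<epsilon> n. \<exists>p\<in>endograph (us n). sum_dist (x, t) p < \<epsilon>"
  have "endograph (us n) \<noteq> {}" for n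
    using F1_USC_values(1)[OF us, of n] by (auto simp: endograph_def intro!: exI[of _ 0])
  then have iff: "Gamma_converges us u \<longleftrightarrow>
      (\<forall>(x, t)\<in>endograph u. \<forall>\<epsilon>>0. \<forall>\<^sub>F n in sequentially. ?near x t \<epsilon> n) \<and>
      (\<forall>(x, t)\<in>UNIV \<times> {0..1}. (\<forall>\<epsilon>>0. \<exists>\<^sub>F n in sequentially. ?near x t \<epsilon> n) \<longrightarrow>
         (x, t) \<in> endograph u)"
    unfolding Gamma_converges_def
    by (subst Kuratowski_converges_iff[OF Metric_space_sum_dist])
       (auto simp: endograph_def split_beta)
  have nearI: "?near x t \<epsilon> n"
    if "t \<in> {0..1}" "t \<le> t'" "\<exists>y. dist x y < \<epsilon> / 2 \<and> t' - \<epsilon> / 2 < us n y" for x t t' \<epsilon> n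
    using that endograph_near_if_value_near[of t "us n" _ x \<epsilon>] F1_USC_values(1)[OF us] by fastforce
  show ?thesis
  proof
    assume G: "Gamma_converges us u"
    have ?low
    proof (intro allI impI)
      fix x and \<epsilon> :: real assume "\<epsilon> > 0"
      moreover have "(x, u x) \<in> endograph u"
        using F1_USC_values[OF u] by (simp add: endograph_def)
      ultimately have "\<forall>\<^sub>F n in sequentially. ?near x (u x) \<epsilon> n"
        using G iff by blast
      then show "\<forall>\<^sub>F n in sequentially. \<exists>y. dist x y < \<epsilon> \<and> u x - \<epsilon> < us n y"
        by (rule eventually_mono) (blast intro: value_near_if_endograph_near)
    qed
    moreover have ?upp
    proof (intro allI ballI impI)
      fix x t
      assume t: "t \<in> {0<..1::real}"
        and fr: "\<forall>\<epsilon>>0. \<exists>\<^sub>F n in sequentially. \<exists>y. dist x y < \<epsilon> \<and> t - \<epsilon> < us n y"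
      have "\<exists>\<^sub>F n in sequentially. ?near x t \<epsilon> n" if "\<epsilon> > 0" for \<epsilon>
        using fr[rule_format, OF half_gt_zero[OF that]]
        by (rule frequently_elim1) (rule nearI[of t t], use t in auto)
      moreover have "(x, t) \<in> UNIV \<times> {0..1}" using t by simp
      ultimately have "(x, t) \<in> endograph u" using G iff by blast
      then show "t \<le> u x" by (simp add: endograph_def)
    qed
    ultimately show "?low \<and> ?upp" ..
  next
    assume R: "?low \<and> ?upp"
    have "\<forall>\<^sub>F n in sequentially. ?near x t \<epsilon> n" if "(x, t) \<in> endograph u" "\<epsilon> > 0" for x t \<epsilon>
    proof -
      have t: "t \<in> {0..1}" "t \<le> u x" using that(1) by (auto simp: endograph_def)
      have "\<forall>\<^sub>F n in sequentially. \<exists>y. dist x y < \<epsilon> / 2 \<and> u x - \<epsilon> / 2 < us n y"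
        using R half_gt_zero[OF that(2)] by blast
      then show ?thesis by (rule eventually_mono) (rule nearI[OF t])
    qed
    moreover have "(x, t) \<in> endograph u"
      if t: "t \<in> {0..1}" and fr: "\<forall>\<epsilon>>0. \<exists>\<^sub>F n in sequentially. ?near x t \<epsilon> n" for x t
    proof -
      have "\<exists>\<^sub>F n in sequentially. \<exists>y. dist x y < \<epsilon> \<and> t - \<epsilon> < us n y" if "\<epsilon> > 0" for \<epsilon>
        using fr[rule_format, OF that]
        by (rule frequently_elim1) (blast intro: value_near_if_endograph_near)
      then have "t \<le> u x" if "0 < t" using R t that by simp
      then have "t \<le> u x" using F1_USC_values(1)[OF u, of x] by fastforce
      then show ?thesis using t by (simp add: endograph_def)
    qed
    ultimately show "Gamma_converges us u"
      unfolding iff by blast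
  qed
qed

lemma cut_converges_iff:
  assumes us: "\<And>n. us n \<in> F1_USC" and \<alpha>: "\<alpha> \<in> {0<..<1}"
  shows "cut_converges us u \<alpha> \<longleftrightarrow>
    (\<forall>x. \<alpha> \<le> u x \<longrightarrow> (\<forall>\<epsilon>>0. \<forall>\<^sub>F n in sequentially. \<exists>y. dist x y < \<epsilon> \<and> \<alpha> \<le> us n y)) \<and>
    (\<forall>x. (\<forall>\<epsilon>>0. \<exists>\<^sub>F n in sequentially. \<exists>y. dist x y < \<epsilon> \<and> \<alpha> \<le> us n y) \<longrightarrow> \<alpha> \<le> u x)"
proof -
  have cut: "fuzzy_cut v \<alpha> = {x. \<alpha> \<le> v x}" for v :: "'a \<Rightarrow> real"
    using \<alpha> by (simp add: fuzzy_cut_def)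
  have "fuzzy_cut (us n) \<alpha> \<noteq> {}" for n
    using us[of n] \<alpha> by (simp add: F1_USC_def)
  then show ?thesis
    unfolding cut_converges_def
    by (subst Kuratowski_converges_iff[OF Met_TC.Metric_space_axioms])
       (auto simp: cut Bex_def conj_commute)
qed

section \<open>Exchanging slack in the level for convergence at exact levels\<close>

text \<open>The lower half needs a point near \<open>x\<close> where \<open>u\<close> is strictly above \<open>\<alpha>\<close>; this is exactly what
  \<open>\<alpha> \<notin> P_set u\<close> provides. The excess of \<open>u\<close> over \<open>\<alpha>\<close> at that point pays for the loss in level.\<close>

lemma cut_converges_if_Gamma_converges:
  assumes u: "u \<in> F1_USC" and us: "\<And>n. us n \<in> F1_USC"
    and G: "Gamma_converges us u" and \<alpha>: "\<alpha> \<in> {0<..<1} - P_set u"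
  shows "cut_converges us u \<alpha>"
proof -
  note Gamma = G[unfolded Gamma_converges_iff[OF u us]]
  have \<alpha>01: "\<alpha> \<in> {0<..<1}" using \<alpha> by simp
  have cut: "fuzzy_cut u \<alpha> = {x. \<alpha> \<le> u x}" using \<alpha>01 by (simp add: fuzzy_cut_def)
  have "closed {x. \<alpha> \<le> u x}"
    using u \<alpha>01 cut by (simp add: F1_USC_def) (metis atLeastAtMost_iff less_imp_le)
  then have "closure {x. u x > \<alpha>} \<subseteq> {x. \<alpha> \<le> u x}"
    by (intro closure_minimal) auto
  then have dense: "{x. \<alpha> \<le> u x} \<subseteq> closure {x. u x > \<alpha>}"
    using \<alpha> cut by (auto simp: P_set_def)
  have "\<forall>\<^sub>F n in sequentially. \<exists>y. dist x y < \<epsilon> \<and> \<alpha> \<le> us n y" if x: "\<alpha> \<le> u x" and \<epsilon>: "\<epsilon> > 0" for x \<epsilon>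
  proof -
    obtain x' where x': "u x' > \<alpha>" "dist x' x < \<epsilon> / 2"
    proof -
      have "x \<in> closure {x. u x > \<alpha>}" using dense x by blast
      then show ?thesis
        using that half_gt_zero[OF \<epsilon>] unfolding closure_approachable by blast
    qed
    define \<delta> where "\<delta> = min (\<epsilon> / 2) (u x' - \<alpha>)"
    have "\<delta> > 0" using x' \<epsilon> by (simp add: \<delta>_def)
    then have "\<forall>\<^sub>F n in sequentially. \<exists>y. dist x' y < \<delta> \<and> u x' - \<delta> < us n y"
      using Gamma by blast
    then show ?thesis
    proof (rule eventually_mono)
      fix n assume "\<exists>y. dist x' y < \<delta> \<and> u x' - \<delta> < us n y"
      then obtain y where y: "dist x' y < \<delta>" "u x' - \<delta> < us n y" by blast
      have "dist x y < \<epsilon>"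
        using dist_triangle[of x y x'] y(1) x'(2) by (simp add: \<delta>_def dist_commute)
      moreover have "\<alpha> \<le> us n y" using y(2) by (simp add: \<delta>_def)
      ultimately show "\<exists>y. dist x y < \<epsilon> \<and> \<alpha> \<le> us n y" by blast
    qed
  qed
  moreover have "\<alpha> \<le> u x"
    if fr: "\<forall>\<epsilon>>0. \<exists>\<^sub>F n in sequentially. \<exists>y. dist x y < \<epsilon> \<and> \<alpha> \<le> us n y" for x
  proof -
    have "\<exists>\<^sub>F n in sequentially. \<exists>y. dist x y < \<epsilon> \<and> \<alpha> - \<epsilon> < us n y" if "\<epsilon> > 0" for \<epsilon>
      using fr[rule_format, OF that] by (rule frequently_elim1) (use that in force)
    moreover have "\<alpha> \<in> {0<..1}" using \<alpha>01 by simp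
    ultimately show ?thesis using Gamma by blast
  qed
  ultimately show ?thesis
    unfolding cut_converges_iff[OF us \<alpha>01] by blast
qed

lemma Gamma_converges_if_cut_converges_densely:
  assumes u: "u \<in> F1_USC" and us: "\<And>n. us n \<in> F1_USC"
    and dense: "\<And>a b. 0 \<le> a \<Longrightarrow> a < b \<Longrightarrow> b \<le> 1 \<Longrightarrow> \<exists>\<alpha>. a < \<alpha> \<and> \<alpha> < b \<and> cut_converges us u \<alpha>"
  shows "Gamma_converges us u"
  unfolding Gamma_converges_iff[OF u us]
proof (intro conjI allI ballI impI)
  fix x and \<epsilon> :: real assume \<epsilon>: "\<epsilon> > 0"
  show "\<forall>\<^sub>F n in sequentially. \<exists>y. dist x y < \<epsilon> \<and> u x - \<epsilon> < us n y"
  proof (cases "u x = 0")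
    case True
    have "dist x x < \<epsilon> \<and> u x - \<epsilon> < us n x" for n
      using True \<epsilon> F1_USC_values(1)[OF us, of n x] by simp
    then show ?thesis by (blast intro: always_eventually)
  next
    case False
    then have "max 0 (u x - \<epsilon>) < u x" "u x \<le> 1"
      using \<epsilon> F1_USC_values[OF u, of x] by auto
    then obtain \<alpha> where \<alpha>: "max 0 (u x - \<epsilon>) < \<alpha>" "\<alpha> < u x" "cut_converges us u \<alpha>"
      using dense[of "max 0 (u x - \<epsilon>)" "u x"] by auto
    have "\<alpha> \<in> {0<..<1}" using \<alpha> \<open>u x \<le> 1\<close> by simp
    then have "\<forall>\<^sub>F n in sequentially. \<exists>y. dist x y < \<epsilon> \<and> \<alpha> \<le> us n y"
      using \<alpha>(2,3) \<epsilon> cut_converges_iff[where us = us and u = u, OF us] by (blast intro: less_imp_le)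
    then show ?thesis
      by (rule eventually_mono) (use \<alpha>(1) in force)
  qed
next
  fix x t
  assume t: "t \<in> {0<..1::real}"
    and fr: "\<forall>\<epsilon>>0. \<exists>\<^sub>F n in sequentially. \<exists>y. dist x y < \<epsilon> \<and> t - \<epsilon> < us n y"
  show "t \<le> u x"
  proof (rule ccontr)
    assume "\<not> t \<le> u x"
    then obtain \<alpha> where \<alpha>: "u x < \<alpha>" "\<alpha> < t" "cut_converges us u \<alpha>"
      using dense[of "u x" t] F1_USC_values(1)[OF u, of x] t by auto
    have "\<exists>\<^sub>F n in sequentially. \<exists>y. dist x y < \<epsilon> \<and> \<alpha> \<le> us n y" if "\<epsilon> > 0" for \<epsilon>
    proof -
      have "\<exists>\<^sub>F n in sequentially. \<exists>y. dist x y < min \<epsilon> (t - \<alpha>) \<and> t - min \<epsilon> (t - \<alpha>) < us n y"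
        by (rule fr[rule_format]) (use that \<alpha>(2) in simp)
      then show ?thesis
        by (rule frequently_elim1) force
    qed
    moreover have "\<alpha> \<in> {0<..<1}"
      using \<alpha> t F1_USC_values(1)[OF u, of x] by simp
    ultimately have "\<alpha> \<le> u x"
      using \<alpha>(3) cut_converges_iff[where us = us and u = u, OF us] by blast
    then show False using \<alpha>(1) by simp
  qed
qed

section \<open>The exceptional levels are few\<close>

text \<open>For an exceptional level \<open>\<alpha>\<close> there is a point \<open>x\<close> with \<open>u x = \<alpha>\<close> and \<open>u \<le> \<alpha>\<close> on a ball around
  \<open>x\<close>. Since \<open>x\<close> lies in the separable set \<open>fuzzy_cut u 0\<close>, a smaller ball with centre in a
  countable dense subset and rational radius still contains \<open>x\<close>, and \<open>\<alpha>\<close> is recovered from that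
  ball as the supremum of \<open>u\<close>.\<close>

lemma countable_P_set:
  fixes u :: "'a::metric_space \<Rightarrow> real"
  assumes "separable_space (top_of_set (fuzzy_cut u 0))"
  shows "countable (P_set u)"
proof -
  obtain Q where Q: "countable Q" "fuzzy_cut u 0 \<subseteq> closure Q"
  proof -
    obtain Q where "countable Q" "top_of_set (fuzzy_cut u 0) closure_of Q = fuzzy_cut u 0"
      using assms by (auto simp: separable_space_def)
    moreover have "top_of_set (fuzzy_cut u 0) closure_of Q \<subseteq> closure Q"
      by (auto simp: closure_of_subtopology intro: closure_mono[THEN subsetD, rotated])
    ultimately show ?thesis using that by auto
  qed
  have "P_set u \<subseteq> (\<lambda>(q, r). Sup (u ` ball q r)) ` (Q \<times> \<rat>)"
  proof
    fix \<alpha> assume "\<alpha> \<in> P_set u"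
    then obtain x where \<alpha>: "0 < \<alpha>" and x: "\<alpha> \<le> u x" "x \<notin> closure {x. u x > \<alpha>}"
      by (auto simp: P_set_def fuzzy_cut_def split: if_splits)
    then obtain e where e: "e > 0" "\<And>y. dist y x < e \<Longrightarrow> u y \<le> \<alpha>"
      unfolding closure_approachable by (metis linorder_not_less mem_Collect_eq)
    have "x \<in> fuzzy_cut u 0"
      using \<alpha> x(1) closure_subset[of "{x. u x > 0}"] by (auto simp: fuzzy_cut_def)
    then obtain q where q: "q \<in> Q" "dist q x < e / 2"
      using Q(2) e(1) closure_approachable[of x Q] by (meson half_gt_zero subsetD)
    obtain r where r: "r \<in> \<rat>" "dist q x < r" "r < e / 2"
      using Rats_dense_in_real[OF q(2)] by blast
    have "u y \<le> \<alpha>" if "y \<in> ball q r" for y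
    proof (rule e(2))
      show "dist y x < e"
        using dist_triangle[of y x q] that q(2) r by (simp add: dist_commute)
    qed
    moreover have "u x = \<alpha>" using x(1) e(2)[of x] e(1) by simp
    moreover have "x \<in> ball q r" using r(2) by simp
    ultimately have "Sup (u ` ball q r) = \<alpha>"
      by (intro cSup_eq_maximum) auto
    then show "\<alpha> \<in> (\<lambda>(q, r). Sup (u ` ball q r)) ` (Q \<times> \<rat>)"
      using q(1) r(1) by force
  qed
  then show ?thesis
    using Q(1) countable_rat by (meson countable_SIGMA countable_image countable_subset)
qed

lemma dense_subset_diff_countable_meets_interval:
  fixes N :: "real set"
  assumes N: "countable N" and P: "dense_subset P ({0<..<1} - N)"
    and "0 \<le> a" "a < b" "b \<le> 1"
  shows "\<exists>\<alpha>\<in>P. a < \<alpha> \<and> \<alpha> < b"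
proof -
  have "\<not> {a<..<b} \<subseteq> N"
    using N assms(4) uncountable_open_interval countable_subset by metis
  then obtain \<beta> where \<beta>: "\<beta> \<in> {a<..<b}" "\<beta> \<notin> N" by blast
  then have "\<beta> \<in> closure P"
    using P assms(3,5) by (auto simp: dense_subset_def)
  then have "{a<..<b} \<inter> P \<noteq> {}"
    using \<beta>(1) open_Int_closure_eq_empty[of "{a<..<b}" P] by auto
  then show ?thesis by auto
qed

lemma AE_meets_interval:
  assumes AE: "AE \<alpha> in lebesgue_on {0<..<1}. R \<alpha>" and "0 \<le> a" "a < b" "b \<le> (1::real)"
  shows "\<exists>\<alpha>. a < \<alpha> \<and> \<alpha> < b \<and> R \<alpha>"
proof (rule ccontr)
  assume no: "\<nexists>\<alpha>. a < \<alpha> \<and> \<alpha> < b \<and> R \<alpha>"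
  have "AE \<alpha> in lebesgue. \<alpha> \<in> {0<..<1} \<longrightarrow> R \<alpha>"
    using AE by (simp add: AE_restrict_space_iff)
  then obtain N where N: "N \<in> null_sets lebesgue" "{\<alpha>. \<not> (\<alpha> \<in> {0<..<1} \<longrightarrow> R \<alpha>)} \<subseteq> N"
    by (auto simp: eventually_ae_filter)
  have "{a<..<b} \<subseteq> N"
    using N(2) no assms(2,4) by auto
  then have "negligible {a<..<b}"
    using N(1) negligible_iff_null_sets negligible_subset by blast
  then show False
    using open_not_negligible[of "{a<..<b}"] assms(3) by simp
qed

lemma AE_lebesgue_on_if_countable_exceptions:
  fixes N :: "real set"
  assumes "countable N" and "\<And>\<alpha>. \<alpha> \<in> S - N \<Longrightarrow> R \<alpha>" and "S \<in> sets lebesgue"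
  shows "AE \<alpha> in lebesgue_on S. R \<alpha>"
proof -
  have "N \<in> null_sets lebesgue"
    using countable_imp_null_set_lborel[OF assms(1)] by (rule null_sets_completionI)
  then have "AE \<alpha> in lebesgue. \<alpha> \<in> S \<longrightarrow> R \<alpha>"
    by (rule AE_I') (use assms(2) in auto)
  then show ?thesis
    using assms(3) by (simp add: AE_restrict_space_iff)
qed

section \<open>Equivalence of the five conditions\<close>

theorem theorem4p12:
  fixes u :: "'a::metric_space \<Rightarrow> real"
    and us :: "nat \<Rightarrow> 'a \<Rightarrow> real"
  assumes "u \<in> F1_USC"
    and "\<And>n. us n \<in> F1_USC"
    and "separable_space (top_of_set (fuzzy_cut u 0))"
  shows "(Gamma_converges us u \<longleftrightarrow>
            (AE \<alpha> in lebesgue_on {0<..<1}. cut_converges us u \<alpha>))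
       \<and> (Gamma_converges us u \<longleftrightarrow>
            (\<forall>\<alpha> \<in> {0<..<1} - P_set u. cut_converges us u \<alpha>))
       \<and> (Gamma_converges us u \<longleftrightarrow>
            (\<exists>P. dense_subset P ({0<..<1} - P_set u) \<and> (\<forall>\<alpha>\<in>P. cut_converges us u \<alpha>)))
       \<and> (Gamma_converges us u \<longleftrightarrow>
            (\<exists>P. countable P \<and> dense_subset P ({0<..<1} - P_set u) \<and>
                 (\<forall>\<alpha>\<in>P. cut_converges us u \<alpha>)))"
proof -
  let ?S = "{0<..<1} - P_set u"
  let ?ae = "AE \<alpha> in lebesgue_on {0<..<1}. cut_converges us u \<alpha>"
  let ?all = "\<forall>\<alpha>\<in>?S. cut_converges us u \<alpha>"
  let ?dense = "\<exists>P. dense_subset P ?S \<and> (\<forall>\<alpha>\<in>P. cut_converges us u \<alpha>)"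
  let ?cdense = "\<exists>P. countable P \<and> dense_subset P ?S \<and> (\<forall>\<alpha>\<in>P. cut_converges us u \<alpha>)"
  note P = countable_P_set[OF assms(3)]
  note Gamma_if_dense = Gamma_converges_if_cut_converges_densely[OF assms(1,2)]
  have all: ?all if "Gamma_converges us u"
    using cut_converges_if_Gamma_converges[OF assms(1,2) that] by blast
  have all_ae: ?ae if ?all
    using that by (intro AE_lebesgue_on_if_countable_exceptions[OF P]) auto
  have ae_Gamma: "Gamma_converges us u" if ?ae
    by (rule Gamma_if_dense) (rule AE_meets_interval[OF that])
  have all_cdense: ?cdense if ?all
  proof -
    obtain T where "countable T" "T \<subseteq> ?S" "?S \<subseteq> closure T"
      using separable[of ?S] by metis
    then show ?thesis using that unfolding dense_subset_def by blast
  qed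
  have dense_Gamma: "Gamma_converges us u" if ?dense
    by (rule Gamma_if_dense) (use that dense_subset_diff_countable_meets_interval[OF P] in blast)
  have cdense_dense: ?dense if ?cdense
    using that by blast
  show ?thesis
    using all all_ae ae_Gamma all_cdense cdense_dense dense_Gamma by argo
qed

end
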